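(* Let $G$ be a group. For every probability measure $\mu\in\mathrm{Prob}(G)$, every topologically $\mu$-mixing action of $G$ on a topological space is highly topologically transitive.
   Context: All groups are countable and discrete. $\mathrm{Prob}(G)$ is the set of all countably additive probability measures on $G$, and $\mu^{*n}$ is the $n$-fold convolution of $\mu$ with itself. Let $G$ act continuously on a topological space $X$. For $U,V\subseteq X$ put $N(U,V)=\{g\in G\mid g(U)\cap V\neq\emptyset\}$. The action is topologically transitive if $N(U,V)\ne\emptyset$ for all non-empty open $U,V\subseteq X$. It is topologically $\mu$-mixing if $\lim_{n\to\infty}\mu^{*n}(N(U,V))=1$ for all non-empty open $U,V\subseteq X$. It is highly topologically transitive if for every $k\in\mathbb N$ the diagonal action of $G$ on $X^k$ is topologically transitive; equivalently, for every $k\in\mathbb{N}$ and all non-empty open $U_1,\dots,U_k,V_1,\dots,V_k\subseteq X$ there is $g\in G$ with $g(U_i)\cap V_i\neq\emptyset$ for all $i$. *)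

theory Defs
  imports "HOL-Algebra.Group_Action" "HOL-Probability.Giry_Monad"
begin

definition Prob :: "('g, 'm) monoid_scheme \<Rightarrow> 'g measure set"
  where "Prob G = {\<mu>. prob_space \<mu> \<and> sets \<mu> = Pow (carrier G)}"

definition group_convolution :: "('g, 'm) monoid_scheme \<Rightarrow> 'g measure \<Rightarrow> 'g measure \<Rightarrow> 'g measure"
  where "group_convolution G \<mu> \<nu> =
    distr (\<mu> \<Otimes>\<^sub>M \<nu>) (count_space (carrier G)) (\<lambda>(g, h). g \<otimes>\<^bsub>G\<^esub> h)"

(* The 0-fold convolution is the point mass at the identity, the unit of convolution. *)
primrec convolution_power :: "('g, 'm) monoid_scheme \<Rightarrow> 'g measure \<Rightarrow> nat \<Rightarrow> 'g measure"
  where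
    "convolution_power G \<mu> 0 = return (count_space (carrier G)) \<one>\<^bsub>G\<^esub>"
  | "convolution_power G \<mu> (Suc n) = group_convolution G \<mu> (convolution_power G \<mu> n)"

(* Continuity is joint continuity of G \<times> X \<rightarrow> X, with G carrying the discrete topology. *)
definition continuous_action ::
    "('g, 'm) monoid_scheme \<Rightarrow> 'x topology \<Rightarrow> ('g \<Rightarrow> 'x \<Rightarrow> 'x) \<Rightarrow> bool"
  where "continuous_action G X \<phi> \<longleftrightarrow>
    group_action G (topspace X) \<phi> \<and>
    continuous_map (prod_topology (discrete_topology (carrier G)) X) X (\<lambda>(g, x). \<phi> g x)"

definition hitting_set ::
    "('g, 'm) monoid_scheme \<Rightarrow> ('g \<Rightarrow> 'x \<Rightarrow> 'x) \<Rightarrow> 'x set \<Rightarrow> 'x set \<Rightarrow> 'g set"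
  where "hitting_set G \<phi> U V = {g \<in> carrier G. \<phi> g ` U \<inter> V \<noteq> {}}"

definition topologically_transitive ::
    "('g, 'm) monoid_scheme \<Rightarrow> 'x topology \<Rightarrow> ('g \<Rightarrow> 'x \<Rightarrow> 'x) \<Rightarrow> bool"
  where "topologically_transitive G X \<phi> \<longleftrightarrow>
    (\<forall>U V. openin X U \<and> U \<noteq> {} \<and> openin X V \<and> V \<noteq> {} \<longrightarrow> hitting_set G \<phi> U V \<noteq> {})"

definition topologically_mixing ::
    "('g, 'm) monoid_scheme \<Rightarrow> 'g measure \<Rightarrow> 'x topology \<Rightarrow> ('g \<Rightarrow> 'x \<Rightarrow> 'x) \<Rightarrow> bool"
  where "topologically_mixing G \<mu> X \<phi> \<longleftrightarrow>
    (\<forall>U V. openin X U \<and> U \<noteq> {} \<and> openin X V \<and> V \<noteq> {} \<longrightarrow>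
      (\<lambda>n. measure (convolution_power G \<mu> n) (hitting_set G \<phi> U V)) \<longlonglongrightarrow> 1)"

abbreviation power_topology :: "'x topology \<Rightarrow> nat \<Rightarrow> (nat \<Rightarrow> 'x) topology"
  where "power_topology X k \<equiv> product_topology (\<lambda>_. X) {..<k}"

(* Both restrictions keep the values extensional, as points of the product and
   elements of BijGroup have to be. *)
definition diagonal_action ::
    "'x topology \<Rightarrow> nat \<Rightarrow> ('g \<Rightarrow> 'x \<Rightarrow> 'x) \<Rightarrow> 'g \<Rightarrow> (nat \<Rightarrow> 'x) \<Rightarrow> (nat \<Rightarrow> 'x)"
  where "diagonal_action X k \<phi> g =
    (\<lambda>x \<in> topspace (power_topology X k). \<lambda>i \<in> {..<k}. \<phi> g (x i))"

definition highly_topologically_transitive ::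
    "('g, 'm) monoid_scheme \<Rightarrow> 'x topology \<Rightarrow> ('g \<Rightarrow> 'x \<Rightarrow> 'x) \<Rightarrow> bool"
  where "highly_topologically_transitive G X \<phi> \<longleftrightarrow>
    (\<forall>k. topologically_transitive G (power_topology X k) (diagonal_action X k \<phi>))"

end

theory Submission
  imports Defs
begin

text \<open>
  A topologically mixing action hits from one given open set into another along all but a
  vanishing proportion of the walk \<open>\<mu>\<^sup>*\<^sup>n\<close>.  Prescribing \<open>k\<close> such pairs at once only intersects
  \<open>k\<close> hitting sets; their complements have \<open>\<mu>\<^sup>*\<^sup>n\<close>-mass tending to zero, so for large \<open>n\<close> the sum
  of these masses drops below one and, \<open>\<mu>\<^sup>*\<^sup>n\<close> being a probability measure
  (\<open>convolution_power_in_Prob\<close>), the hitting sets have a common element (\<open>common_hit\<close>).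
  Open boxes form a base of the power topology, and an element that hits every coordinate
  of a box hits the box under the diagonal action (\<open>diagonal_hit\<close>).
\<close>

lemma group_convolution_in_Prob:
  assumes G: "group G" and countable: "countable (carrier G)"
    and \<mu>: "\<mu> \<in> Prob G" and \<nu>: "\<nu> \<in> Prob G"
  shows "group_convolution G \<mu> \<nu> \<in> Prob G"
proof -
  interpret G: group G by fact
  interpret \<mu>: prob_space \<mu> using \<mu> by (simp add: Prob_def)
  interpret \<nu>: prob_space \<nu> using \<nu> by (simp add: Prob_def)
  interpret pair_prob_space \<mu> \<nu> ..
  \<comment> \<open>Countability makes every subset of the square measurable, hence also multiplication.\<close>
  have sets: "sets (\<mu> \<Otimes>\<^sub>M \<nu>) = sets (count_space (carrier G \<times> carrier G))"
    using countable \<mu> \<nu> by (simp add: Prob_def sets_pair_countable)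
  have "(\<lambda>(g, h). g \<otimes>\<^bsub>G\<^esub> h) \<in> measurable (\<mu> \<Otimes>\<^sub>M \<nu>) (count_space (carrier G))"
    unfolding measurable_cong_sets[OF sets refl] by auto
  then have "prob_space (group_convolution G \<mu> \<nu>)"
    unfolding group_convolution_def by (rule prob_space_distr)
  then show ?thesis
    by (simp add: Prob_def group_convolution_def)
qed

lemma convolution_power_in_Prob:
  assumes "group G" "countable (carrier G)" "\<mu> \<in> Prob G"
  shows "convolution_power G \<mu> n \<in> Prob G"
proof (induction n)
  case 0
  interpret group G by fact
  show ?case
    by (simp add: Prob_def prob_space_return)
next
  case (Suc n)
  then show ?case
    using assms by (simp add: group_convolution_in_Prob)
qed

text \<open>The union bound, applied to the complements.\<close>

lemma (in prob_space) Inter_events_nonempty: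
  assumes "finite I" and A: "\<And>i. i \<in> I \<Longrightarrow> A i \<in> events"
    and small: "(\<Sum>i\<in>I. 1 - prob (A i)) < 1"
  shows "\<exists>\<omega>\<in>space M. \<forall>i\<in>I. \<omega> \<in> A i"
proof (rule ccontr)
  assume "\<not> ?thesis"
  then have "space M = (\<Union>i\<in>I. space M - A i)"
    by blast
  then have "1 = prob (\<Union>i\<in>I. space M - A i)"
    using prob_space by simp
  also have "\<dots> \<le> (\<Sum>i\<in>I. prob (space M - A i))"
    using assms by (intro finite_measure_subadditive_finite) auto
  also have "\<dots> = (\<Sum>i\<in>I. 1 - prob (A i))"
    using A by (simp add: prob_compl)
  finally show False
    using small by simp
qed

lemma common_hit:
  assumes "group G" "countable (carrier G)" "\<mu> \<in> Prob G"
    and mixing: "topologically_mixing G \<mu> X \<phi>" and I: "finite I"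
    and U: "\<And>i. i \<in> I \<Longrightarrow> openin X (U i) \<and> U i \<noteq> {}"
    and V: "\<And>i. i \<in> I \<Longrightarrow> openin X (V i) \<and> V i \<noteq> {}"
  shows "\<exists>g\<in>carrier G. \<forall>i\<in>I. g \<in> hitting_set G \<phi> (U i) (V i)"
proof -
  define M where "M = convolution_power G \<mu>"
  define A where "A i = hitting_set G \<phi> (U i) (V i)" for i
  have "(\<lambda>n. measure (M n) (A i)) \<longlonglongrightarrow> 1" if "i \<in> I" for i
    using mixing U V that by (auto simp: topologically_mixing_def M_def A_def)
  then have "(\<lambda>n. \<Sum>i\<in>I. 1 - measure (M n) (A i)) \<longlonglongrightarrow> (\<Sum>i\<in>I. 1 - 1)"
    by (intro tendsto_intros)
  then have "\<forall>\<^sub>F n in sequentially. (\<Sum>i\<in>I. 1 - measure (M n) (A i)) < 1"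
    by (rule order_tendstoD(2)) simp
  then obtain n where n: "(\<Sum>i\<in>I. 1 - measure (M n) (A i)) < 1"
    by (auto simp: eventually_sequentially)
  have "M n \<in> Prob G"
    using assms(1-3) by (simp add: M_def convolution_power_in_Prob)
  then have prob: "prob_space (M n)" and sets: "sets (M n) = sets (count_space (carrier G))"
    by (simp_all add: Prob_def)
  then have "\<exists>g\<in>space (M n). \<forall>i\<in>I. g \<in> A i"
    using I n by (intro prob_space.Inter_events_nonempty) (auto simp: A_def hitting_set_def)
  then show ?thesis
    using sets_eq_imp_space_eq[OF sets] by (simp add: A_def)
qed

lemma nonempty_open_contains_box:
  assumes "openin (power_topology X k) W" "W \<noteq> {}"
  shows "\<exists>U. (\<forall>i<k. openin X (U i) \<and> U i \<noteq> {}) \<and> (\<Pi>\<^sub>E i\<in>{..<k}. U i) \<subseteq> W"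
proof -
  obtain x where "x \<in> W"
    using assms(2) by auto
  then obtain U where U: "\<forall>i\<in>{..<k}. openin X (U i)" "x \<in> (\<Pi>\<^sub>E i\<in>{..<k}. U i)"
      "(\<Pi>\<^sub>E i\<in>{..<k}. U i) \<subseteq> W"
    using assms(1) by (force simp: openin_product_topology_alt)
  then show ?thesis
    by (intro exI[of _ U]) (auto dest: PiE_mem)
qed

lemma diagonal_hit:
  assumes g: "g \<in> carrier G"
    and U: "\<And>i. i < k \<Longrightarrow> U i \<subseteq> topspace X"
    and hit: "\<And>i. i < k \<Longrightarrow> g \<in> hitting_set G \<phi> (U i) (V i)"
  shows "g \<in> hitting_set G (diagonal_action X k \<phi>)
    (\<Pi>\<^sub>E i\<in>{..<k}. U i) (\<Pi>\<^sub>E i\<in>{..<k}. V i)"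
proof -
  have "\<forall>i\<in>{..<k}. \<exists>y. y \<in> U i \<and> \<phi> g y \<in> V i"
    using hit by (fastforce simp: hitting_set_def)
  then obtain y where y: "\<And>i. i < k \<Longrightarrow> y i \<in> U i \<and> \<phi> g (y i) \<in> V i"
    by (metis lessThan_iff)
  define x where "x = restrict y {..<k}"
  have x: "x \<in> (\<Pi>\<^sub>E i\<in>{..<k}. U i)"
    using y by (auto simp: x_def)
  have "x \<in> topspace (power_topology X k)"
    using y U by (auto simp: x_def)
  then have "diagonal_action X k \<phi> g x \<in> (\<Pi>\<^sub>E i\<in>{..<k}. V i)"
    using y by (auto simp: diagonal_action_def x_def)
  with x g show ?thesis
    by (auto simp: hitting_set_def)
qed

theorem proposition1p2:
  fixes G :: "('g, 'm) monoid_scheme"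
    and \<mu> :: "'g measure"
    and X :: "'x topology"
    and \<phi> :: "'g \<Rightarrow> 'x \<Rightarrow> 'x"
  assumes "group G" and "countable (carrier G)"
    and "\<mu> \<in> Prob G"
    and "continuous_action G X \<phi>"
    and "topologically_mixing G \<mu> X \<phi>"
  shows "highly_topologically_transitive G X \<phi>"
  unfolding highly_topologically_transitive_def topologically_transitive_def
proof (intro allI impI, elim conjE)
  fix k W Z
  assume "openin (power_topology X k) W" "W \<noteq> {}" "openin (power_topology X k) Z" "Z \<noteq> {}"
  then obtain U V where U: "\<And>i. i < k \<Longrightarrow> openin X (U i) \<and> U i \<noteq> {}"
      and UW: "(\<Pi>\<^sub>E i\<in>{..<k}. U i) \<subseteq> W"
      and V: "\<And>i. i < k \<Longrightarrow> openin X (V i) \<and> V i \<noteq> {}"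
      and VZ: "(\<Pi>\<^sub>E i\<in>{..<k}. V i) \<subseteq> Z"
    by (metis nonempty_open_contains_box)
  obtain g where "g \<in> carrier G" "\<And>i. i < k \<Longrightarrow> g \<in> hitting_set G \<phi> (U i) (V i)"
    using common_hit[OF assms(1-3,5), of "{..<k}" U V] U V by auto
  then have "g \<in> hitting_set G (diagonal_action X k \<phi>)
      (\<Pi>\<^sub>E i\<in>{..<k}. U i) (\<Pi>\<^sub>E i\<in>{..<k}. V i)"
    using U by (intro diagonal_hit) (auto dest: openin_subset)
  then have "g \<in> hitting_set G (diagonal_action X k \<phi>) W Z"
    using UW VZ unfolding hitting_set_def by blast
  then show "hitting_set G (diagonal_action X k \<phi>) W Z \<noteq> {}"
    by blast
qed

end
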